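(* For all $n,m,\ell\ge0$, \[ \mathcal{L}(x^nP_m(x)Q_\ell(x))=\sum_{\pi\in\mathrm{MS}((0,m)\to(n,\ell))}\mathrm{wt}(\pi), \] where $\mathrm{MS}((0,m)\to(n,\ell))$ is the set of Motzkin–Schröder paths from $(0,m)$ to $(n,\ell)$.
   Context: Let $\{b_n\}_{n\ge0},\{a_n\}_{n\ge0},\{\lambda_n\}_{n\ge0}$ be sequences of complex numbers. Define monic polynomials $P_n(x)$ by $P_{-1}(x)=0$, $P_0(x)=1$ and $P_{n+1}(x)=(x-b_n)P_n(x)-(a_nx+\lambda_n)P_{n-1}(x)$ for $n\ge0$. Let $d_0(x)=1$, $d_m(x)=\prod_{i=1}^m(a_ix+\lambda_i)$, and $Q_m(x)=P_m(x)/d_m(x)$. Assume $a_n\neq0$ and $P_n(-\lambda_n/a_n)\neq 0$ for all $n\ge1$. Let $V=\mathrm{span}\{x^nQ_m(x):n,m\ge0\}$ (rational functions), and let $\mathcal{L}$ be the unique linear functional on $V$ with $\mathcal{L}(1)=1$ and $\mathcal{L}(x^nQ_m(x))=0$ whenever $0\le n<m$. A Motzkin–Schröder path is a lattice path never going below the $x$-axis with steps: up $U=(1,1)$, horizontal $H=(1,0)$, vertical down $V=(0,-1)$, diagonal down $D=(1,-1)$. Its weight $\mathrm{wt}(\pi)$ is the product of step weights: each up step has weight $1$; a horizontal step starting at height $k$ has weight $b_k$; a vertical down step starting at height $k$ has weight $a_k$; a diagonal down step starting at height $k$ has weight $\lambda_k$. *)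

theory Defs
  imports Complex_Main
    "HOL-Library.Product_Plus"
    "HOL-Computational_Algebra.Polynomial"
    "HOL-Computational_Algebra.Polynomial_Factorial"
begin

text \<open>The second clause is the recurrence at \<open>n = 0\<close> with \<open>P\<^sub>-\<^sub>1 = 0\<close>.\<close>

fun P :: "(nat \<Rightarrow> complex) \<Rightarrow> (nat \<Rightarrow> complex) \<Rightarrow> (nat \<Rightarrow> complex) \<Rightarrow> nat \<Rightarrow> complex poly"
where
  "P b a lam 0 = 1"
| "P b a lam (Suc 0) = [:- b 0, 1:]"
| "P b a lam (Suc (Suc n)) =
     [:- b (Suc n), 1:] * P b a lam (Suc n) - [:lam (Suc n), a (Suc n):] * P b a lam n"

definition d :: "(nat \<Rightarrow> complex) \<Rightarrow> (nat \<Rightarrow> complex) \<Rightarrow> nat \<Rightarrow> complex poly" where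
  "d a lam m = (\<Prod>i=1..m. [:lam i, a i:])"

type_synonym ratfun = "complex poly fract"

definition Q :: "(nat \<Rightarrow> complex) \<Rightarrow> (nat \<Rightarrow> complex) \<Rightarrow> (nat \<Rightarrow> complex) \<Rightarrow> nat \<Rightarrow> ratfun" where
  "Q b a lam m = to_fract (P b a lam m) / to_fract (d a lam m)"

definition X :: ratfun where
  "X = to_fract [:0, 1:]"

definition scale_rf :: "complex \<Rightarrow> ratfun \<Rightarrow> ratfun" where
  "scale_rf c f = to_fract [:c:] * f"

global_interpretation rf: vector_space scale_rf
proof
  fix c e :: complex and f g :: ratfun
  show "scale_rf c (f + g) = scale_rf c f + scale_rf c g"
    by (simp add: scale_rf_def algebra_simps)
  have "to_fract [:c + e:] = to_fract [:c:] + to_fract [:e:]"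
    by (simp flip: to_fract_add)
  then show "scale_rf (c + e) f = scale_rf c f + scale_rf e f"
    by (simp add: scale_rf_def algebra_simps)
  have "to_fract [:c * e:] = to_fract [:c:] * to_fract [:e:]"
    by (simp flip: to_fract_mult)
  then show "scale_rf c (scale_rf e f) = scale_rf (c * e) f"
    by (simp add: scale_rf_def algebra_simps)
  show "scale_rf 1 f = f"
    by (simp add: scale_rf_def flip: one_pCons)
qed

definition V :: "(nat \<Rightarrow> complex) \<Rightarrow> (nat \<Rightarrow> complex) \<Rightarrow> (nat \<Rightarrow> complex) \<Rightarrow> ratfun set" where
  "V b a lam = rf.span {X ^ n * Q b a lam m | n m. True}"

text \<open>A functional on a subspace is a total function whose values off the subspace are arbitrary.\<close>

definition linear_functional_on :: "ratfun set \<Rightarrow> (ratfun \<Rightarrow> complex) \<Rightarrow> bool" where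
  "linear_functional_on W L \<longleftrightarrow>
     (\<forall>f\<in>W. \<forall>g\<in>W. L (f + g) = L f + L g) \<and>
     (\<forall>c. \<forall>f\<in>W. L (scale_rf c f) = c * L f)"

datatype ms_step = Up | Horizontal | Vertical | Diagonal

fun step_vec :: "ms_step \<Rightarrow> int \<times> int" where
  "step_vec Up = (1, 1)"
| "step_vec Horizontal = (1, 0)"
| "step_vec Vertical = (0, -1)"
| "step_vec Diagonal = (1, -1)"

text \<open>A path is encoded by its starting point together with its list of steps.\<close>

fun vertices :: "int \<times> int \<Rightarrow> ms_step list \<Rightarrow> (int \<times> int) list" where
  "vertices p [] = [p]"
| "vertices p (s # ss) = p # vertices (p + step_vec s) ss"

definition MS :: "int \<times> int \<Rightarrow> int \<times> int \<Rightarrow> ms_step list set" where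
  "MS p q = {ss. last (vertices p ss) = q \<and> (\<forall>v\<in>set (vertices p ss). snd v \<ge> 0)}"

fun step_wt :: "(nat \<Rightarrow> complex) \<Rightarrow> (nat \<Rightarrow> complex) \<Rightarrow> (nat \<Rightarrow> complex) \<Rightarrow> nat \<Rightarrow> ms_step \<Rightarrow> complex"
where
  "step_wt b a lam k Up = 1"
| "step_wt b a lam k Horizontal = b k"
| "step_wt b a lam k Vertical = a k"
| "step_wt b a lam k Diagonal = lam k"

fun wt :: "(nat \<Rightarrow> complex) \<Rightarrow> (nat \<Rightarrow> complex) \<Rightarrow> (nat \<Rightarrow> complex) \<Rightarrow>
    int \<times> int \<Rightarrow> ms_step list \<Rightarrow> complex"
where
  "wt b a lam p [] = 1"
| "wt b a lam p (s # ss) = step_wt b a lam (nat (snd p)) s * wt b a lam (p + step_vec s) ss"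

lemma vertices_nonempty [simp]: "vertices p ss \<noteq> []"
  by (cases ss) auto

lemma length_path_le:
  assumes "last (vertices p ss) = q"
  shows "int (length ss) \<le> 2 * (fst q - fst p) - (snd q - snd p)"
  using assms
proof (induction ss arbitrary: p)
  case (Cons s ss)
  then have "int (length ss) \<le>
      2 * (fst q - fst (p + step_vec s)) - (snd q - snd (p + step_vec s))"
    by (intro Cons.IH) simp
  then show ?case
    by (cases s) auto
qed simp

text \<open>Finiteness ensures that a sum over this set is a genuine finite sum.\<close>

lemma finite_MS: "finite (MS p q)"
proof (rule finite_subset)
  let ?N = "nat (2 * (fst q - fst p) - (snd q - snd p))"
  have fin: "finite (UNIV :: ms_step set)"
  proof (rule finite_subset)
    show "(UNIV :: ms_step set) \<subseteq> {Up, Horizontal, Vertical, Diagonal}"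
      using ms_step.exhaust by blast
  qed simp
  show "MS p q \<subseteq> {ss. set ss \<subseteq> UNIV \<and> length ss \<le> ?N}"
  proof
    fix ss assume "ss \<in> MS p q"
    then have "int (length ss) \<le> 2 * (fst q - fst p) - (snd q - snd p)"
      by (intro length_path_le) (simp add: MS_def)
    then show "ss \<in> {ss. set ss \<subseteq> UNIV \<and> length ss \<le> ?N}"
      by simp
  qed
  show "finite {ss. set ss \<subseteq> (UNIV :: ms_step set) \<and> length ss \<le> ?N}"
    using fin by (rule finite_lists_length_le)
qed

end

theory Submission
  imports Defs
begin

text \<open>
  Both sides satisfy the same recurrence in \<open>n\<close> and \<open>m\<close>: splitting a path at its first step
  corresponds to \<open>x P\<^sub>m = P\<^sub>m\<^sub>+\<^sub>1 + b\<^sub>m P\<^sub>m + (a\<^sub>m x + \<lambda>\<^sub>m) P\<^sub>m\<^sub>-\<^sub>1\<close>. It remains to treat \<open>n = 0\<close>, where only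
  vertical steps are possible. The three-term recurrence for the \<open>Q\<^sub>m\<close> gives \<open>L (x\<^sup>m Q\<^sub>m) = 1\<close>, hence
  \<open>L (p Q\<^sub>m)\<close> is the coefficient of \<open>x\<^sup>m\<close> in \<open>p\<close> for every polynomial \<open>p\<close> of degree at most \<open>m\<close>.
  For \<open>m \<ge> l\<close> one has \<open>P\<^sub>m Q\<^sub>l = (P\<^sub>l d\<^sub>m / d\<^sub>l) Q\<^sub>m\<close>, so that \<open>L (P\<^sub>m Q\<^sub>l) = a\<^sub>l\<^sub>+\<^sub>1 \<cdots> a\<^sub>m\<close>.
\<close>

section \<open>Paths\<close>

definition path_sum ::
  "(nat \<Rightarrow> complex) \<Rightarrow> (nat \<Rightarrow> complex) \<Rightarrow> (nat \<Rightarrow> complex) \<Rightarrow> int \<times> int \<Rightarrow> int \<times> int \<Rightarrow> complex"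
where
  "path_sum b a lam p q = (\<Sum>\<pi>\<in>MS p q. wt b a lam p \<pi>)"

lemma fst_le_fst_last_vertices: "fst p \<le> fst (last (vertices p ss))"
proof (induction ss arbitrary: p)
  case (Cons s ss)
  from Cons.IH[of "p + step_vec s"] show ?case
    by (cases s) auto
qed simp

text \<open>No step moves left. Once the start lies in the target column, this discards every first
  step except a vertical one.\<close>

lemma path_sum_backward: "fst q < fst p \<Longrightarrow> path_sum b a lam p q = 0"
proof -
  assume "fst q < fst p"
  then have "last (vertices p ss) \<noteq> q" for ss
    using fst_le_fst_last_vertices[of p ss] by auto
  then have "MS p q = {}"
    by (simp add: MS_def)
  then show ?thesis
    by (simp add: path_sum_def)
qed

lemma path_sum_below: "snd p < 0 \<Longrightarrow> path_sum b a lam p q = 0"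
proof -
  assume "snd p < 0"
  moreover have "p \<in> set (vertices p ss)" for ss
    by (cases ss) auto
  ultimately have "MS p q = {}"
    by (force simp: MS_def)
  then show ?thesis
    by (simp add: path_sum_def)
qed

lemma MS_first_step:
  assumes "snd p \<ge> 0"
  shows "MS p q = (if p = q then {[]} else {}) \<union> (\<Union>s. (#) s ` MS (p + step_vec s) q)"
proof (rule set_eqI)
  fix ss
  show "ss \<in> MS p q \<longleftrightarrow> ss \<in> (if p = q then {[]} else {}) \<union> (\<Union>s. (#) s ` MS (p + step_vec s) q)"
    using assms by (cases ss) (auto simp: MS_def)
qed

lemma UNIV_ms_step: "UNIV = {Up, Horizontal, Vertical, Diagonal}"
  using ms_step.exhaust by blast

lemma path_sum_first_step:
  assumes "snd p \<ge> 0"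
  shows "path_sum b a lam p q = of_bool (p = q) +
    (\<Sum>s\<in>UNIV. step_wt b a lam (nat (snd p)) s * path_sum b a lam (p + step_vec s) q)"
proof -
  have fin: "finite (UNIV :: ms_step set)"
    by (simp add: UNIV_ms_step)
  have "path_sum b a lam p q = (\<Sum>\<pi>\<in>(if p = q then {[]} else {}). wt b a lam p \<pi>) +
      (\<Sum>\<pi>\<in>(\<Union>s. (#) s ` MS (p + step_vec s) q). wt b a lam p \<pi>)"
    unfolding path_sum_def MS_first_step[OF assms]
    by (rule sum.union_disjoint) (use fin in \<open>auto simp: finite_MS\<close>)
  also have "(\<Sum>\<pi>\<in>(\<Union>s. (#) s ` MS (p + step_vec s) q). wt b a lam p \<pi>) =
      (\<Sum>s\<in>UNIV. \<Sum>\<pi>\<in>(#) s ` MS (p + step_vec s) q. wt b a lam p \<pi>)"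
    by (rule sum.UNION_disjoint) (use fin in \<open>auto simp: finite_MS\<close>)
  also have "\<dots> = (\<Sum>s\<in>UNIV. step_wt b a lam (nat (snd p)) s * path_sum b a lam (p + step_vec s) q)"
    by (simp add: path_sum_def sum.reindex sum_distrib_left)
  finally show ?thesis
    by simp
qed

text \<open>For \<open>m = 0\<close> both down steps leave the upper half-plane, and
  \<open>path_sum_below\<close> removes them. The vertical step keeps \<open>x\<close>, so it is the
  drop in height that makes this term smaller.\<close>

lemma path_sum_rec:
  "path_sum b a lam (x, int m) q = of_bool ((x, int m) = q) +
     path_sum b a lam (x + 1, int (Suc m)) q + b m * path_sum b a lam (x + 1, int m) q +
     (if m = 0 then 0
      else a m * path_sum b a lam (x, int (m - 1)) q
         + lam m * path_sum b a lam (x + 1, int (m - 1)) q)"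
  by (subst path_sum_first_step)
     (auto simp: UNIV_ms_step path_sum_below of_nat_diff algebra_simps)

section \<open>Degrees and leading coefficients\<close>

lemma linear_factor_mult:
  fixes p :: "'a::comm_ring_1 poly"
  assumes "degree p \<le> n"
  shows degree_linear_factor_mult_le: "degree ([:c, e:] * p) \<le> Suc n"
    and coeff_linear_factor_mult: "coeff ([:c, e:] * p) (Suc n) = e * coeff p n"
proof -
  show "degree ([:c, e:] * p) \<le> Suc n"
    using assms degree_mult_le[of "[:c, e:]" p] by (auto split: if_splits)
  show "coeff ([:c, e:] * p) (Suc n) = e * coeff p n"
    using assms by (simp add: coeff_eq_0)
qed

lemma P_monic: "degree (P b a lam n) \<le> n \<and> coeff (P b a lam n) n = 1"
proof (induction b a lam n rule: P.induct)
  case (3 b a lam n)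
  have "degree ([:- b (Suc n), 1:] * P b a lam (Suc n)) \<le> Suc (Suc n)"
       "degree ([:lam (Suc n), a (Suc n):] * P b a lam n) \<le> Suc n"
    using 3 by (blast intro: degree_linear_factor_mult_le)+
  moreover have "coeff ([:- b (Suc n), 1:] * P b a lam (Suc n)) (Suc (Suc n)) = 1"
    using 3 by (subst coeff_linear_factor_mult) auto
  moreover have "coeff ([:lam (Suc n), a (Suc n):] * P b a lam n) (Suc (Suc n)) = 0"
    using calculation(2) by (intro coeff_eq_0) simp
  ultimately show ?case
    by (simp only: P.simps coeff_diff) (auto intro: degree_diff_le)
qed auto

text \<open>Meant for the quotient of \<open>d a lam (l + k)\<close> by \<open>d a lam l\<close>,
  which is a product of linear factors with leading coefficients \<open>a i\<close>.\<close>

lemma linear_factors_mult: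
  fixes p :: "'a::comm_ring_1 poly"
  assumes "degree p \<le> l"
  shows "degree (p * (\<Prod>i=Suc l..l + k. [:c i, e i:])) \<le> l + k \<and>
    coeff (p * (\<Prod>i=Suc l..l + k. [:c i, e i:])) (l + k) = coeff p l * (\<Prod>i=Suc l..l + k. e i)"
proof (induction k)
  case (Suc k)
  let ?r = "p * (\<Prod>i=Suc l..l + k. [:c i, e i:])"
  have "p * (\<Prod>i=Suc l..l + Suc k. [:c i, e i:]) = [:c (Suc (l + k)), e (Suc (l + k)):] * ?r"
    by (simp only: add_Suc_right prod.nat_ivl_Suc' le_add1 Suc_le_mono ac_simps)
  with Suc show ?case
    using degree_linear_factor_mult_le[of ?r "l + k"] coeff_linear_factor_mult[of ?r "l + k"]
    by (simp only: add_Suc_right prod.nat_ivl_Suc' le_add1 Suc_le_mono ac_simps)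
qed (use assms in simp)

lemma P_rec:
  "[:0, 1:] * P b a lam m = P b a lam (Suc m) + smult (b m) (P b a lam m) +
     (if m = 0 then 0 else [:lam m, a m:] * P b a lam (m - 1))"
  by (cases m) (simp_all add: algebra_simps)

section \<open>The functional\<close>

lemma to_fract_pCons: "to_fract (pCons c p) = to_fract [:c:] + X * to_fract p"
  by (simp add: X_def flip: to_fract_add to_fract_mult)

lemma power_X_eq: "X ^ k = to_fract (monom 1 k)"
proof (induction k)
  case (Suc k)
  then show ?case
    by (simp add: X_def monom_Suc flip: to_fract_mult)
qed (simp add: monom_0 flip: one_pCons)

locale rational_moment_functional =
  fixes a b lam :: "nat \<Rightarrow> complex" and L :: "ratfun \<Rightarrow> complex"
  assumes a_nonzero: "k \<ge> 1 \<Longrightarrow> a k \<noteq> 0"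
    and L_linear: "linear_functional_on (V b a lam) L"
    and L_one: "L 1 = 1"
    and L_orthogonal: "i < j \<Longrightarrow> L (X ^ i * Q b a lam j) = 0"
begin

text \<open>For fixed \<open>m\<close> this is linear in a polynomial argument, so most of the
  argument can avoid rational functions.\<close>

definition Lp :: "nat \<Rightarrow> complex poly \<Rightarrow> complex" where
  "Lp m p = L (to_fract p * Q b a lam m)"

text \<open>The factor \<open>X ^ k\<close> is there for the induction on \<open>p\<close>: peeling
  off a constant coefficient raises \<open>k\<close> by one.\<close>

lemma power_X_mult_poly_mult_Q_in_V: "X ^ k * to_fract p * Q b a lam m \<in> V b a lam"
proof (induction p arbitrary: k)
  case 0
  then show ?case
    by (simp add: V_def rf.span_zero)
next
  case (pCons c p)
  have "X ^ k * Q b a lam m \<in> V b a lam"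
    unfolding V_def by (rule rf.span_base) blast
  then have "scale_rf c (X ^ k * Q b a lam m) + X ^ Suc k * to_fract p * Q b a lam m \<in> V b a lam"
    using pCons.IH[of "Suc k"] by (auto simp: V_def intro: rf.span_add rf.span_scale)
  then show ?case
    by (subst to_fract_pCons) (simp add: scale_rf_def algebra_simps)
qed

lemma poly_mult_Q_in_V: "to_fract p * Q b a lam m \<in> V b a lam"
  using power_X_mult_poly_mult_Q_in_V[of 0] by simp

lemma Lp_add: "Lp m (p + q) = Lp m p + Lp m q"
  using L_linear poly_mult_Q_in_V
  by (simp add: Lp_def linear_functional_on_def distrib_right to_fract_add)

lemma Lp_smult: "Lp m (smult c p) = c * Lp m p"
proof -
  have "to_fract (smult c p) = to_fract [:c:] * to_fract p"
    by (simp flip: to_fract_mult)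
  then have "Lp m (smult c p) = L (scale_rf c (to_fract p * Q b a lam m))"
    by (simp add: Lp_def scale_rf_def mult.assoc)
  then show ?thesis
    using L_linear poly_mult_Q_in_V by (simp add: Lp_def linear_functional_on_def)
qed

lemma Lp_zero: "Lp m 0 = 0"
  using Lp_smult[of m 0 0] by simp

lemma Lp_sum: "Lp m (sum f A) = (\<Sum>i\<in>A. Lp m (f i))"
  by (induction A rule: infinite_finite_induct) (simp_all add: Lp_zero Lp_add)

lemma Lp_monom_lt: "i < j \<Longrightarrow> Lp j (monom 1 i) = 0"
  using L_orthogonal by (simp add: Lp_def power_X_eq)

section \<open>Orthogonality and extraction of the top coefficient\<close>

lemma d_nonzero: "d a lam m \<noteq> 0"
  using a_nonzero by (auto simp: d_def)

text \<open>This is the recurrence for \<open>P\<close> divided by \<open>d a lam (Suc n)\<close>;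
  each of the outer terms differs from its own denominator by one linear factor, nonzero because
  \<open>a\<close> does not vanish there.\<close>

lemma Q_rec:
  "to_fract [:lam (Suc (Suc n)), a (Suc (Suc n)):] * Q b a lam (Suc (Suc n)) =
   to_fract [:- b (Suc n), 1:] * Q b a lam (Suc n) - Q b a lam n"
proof -
  define e where "e k = to_fract [:lam (Suc k), a (Suc k):]" for k
  have d: "to_fract (d a lam (Suc k)) = to_fract (d a lam k) * e k" for k
    by (simp add: d_def e_def mult.commute flip: to_fract_mult)
  have "to_fract (d a lam k) \<noteq> 0" "e k \<noteq> 0" for k
    using d_nonzero[of k] a_nonzero[of "Suc k"] by (simp_all add: e_def)
  then show ?thesis
    unfolding Q_def P.simps d to_fract_mult to_fract_diff e_def[symmetric]
    by (simp add: field_simps)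
qed

text \<open>Orthogonality kills all monomials below degree \<open>m\<close>. The value at the top
  monomial is still unknown here.\<close>

lemma Lp_degree_le_aux:
  assumes "degree p \<le> m"
  shows "Lp m p = coeff p m * Lp m (monom 1 m)"
proof -
  have "p = (\<Sum>i\<le>m. smult (coeff p i) (monom 1 i))"
    using assms by (simp add: poly_as_sum_of_monoms' smult_monom)
  then have "Lp m p = Lp m (\<Sum>i\<le>m. smult (coeff p i) (monom 1 i))"
    by simp
  also have "\<dots> = (\<Sum>i\<le>m. coeff p i * Lp m (monom 1 i))"
    by (simp only: Lp_sum Lp_smult)
  also have "\<dots> = (\<Sum>i\<in>{m}. coeff p i * Lp m (monom 1 i))"
    by (rule sum.mono_neutral_right) (auto simp: Lp_monom_lt)
  finally show ?thesis
    by simp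
qed

text \<open>Multiply \<open>Q_rec\<close> by x^n and apply \<open>L\<close>. The factor
  \<open>?u\<close> has degree at most n+1, below its index n+2, so its term vanishes;
  \<open>?v\<close> is monic of degree n+1. Hence the value at n+1 equals the value at n.\<close>

lemma Lp_monom_eq: "Lp m (monom 1 m) = 1"
proof (induction m)
  case 0
  show ?case
    using L_one by (simp add: Lp_def Q_def d_def monom_0 flip: one_pCons)
next
  case (Suc n)
  let ?u = "[:lam (Suc (Suc n)), a (Suc (Suc n)):] * monom 1 n"
  let ?v = "[:- b (Suc n), 1:] * monom 1 n"
  have "degree (monom (1 :: complex) n) \<le> n"
    by (rule degree_monom_le)
  note u = degree_linear_factor_mult_le[OF this] and v = coeff_linear_factor_mult[OF this]
  have "to_fract ?v * Q b a lam (Suc n) =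
      to_fract ?u * Q b a lam (Suc (Suc n)) + to_fract (monom 1 n) * Q b a lam n"
    using arg_cong[OF Q_rec[of n], of "\<lambda>t. to_fract (monom 1 n) * t"]
    by (simp only: to_fract_mult) (simp add: algebra_simps)
  then have "Lp (Suc n) ?v = Lp (Suc (Suc n)) ?u + Lp n (monom 1 n)"
    using L_linear poly_mult_Q_in_V
    by (simp only: Lp_def linear_functional_on_def)
  moreover have "Lp (Suc (Suc n)) ?u = 0"
    using u by (subst Lp_degree_le_aux) (simp_all only: coeff_eq_0 less_Suc_eq_le le_SucI mult_zero_left)
  moreover have "Lp (Suc n) ?v = Lp (Suc n) (monom 1 (Suc n))"
    using u v by (subst Lp_degree_le_aux) (simp_all only: coeff_monom mult_1_left refl if_True)
  ultimately show ?case
    using Suc.IH by simp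
qed

lemma Lp_degree_le: "degree p \<le> m \<Longrightarrow> Lp m p = coeff p m"
  using Lp_degree_le_aux Lp_monom_eq by simp

section \<open>Values on products of \<open>P\<close> and \<open>Q\<close>, and comparison with path
  sums\<close>

lemma Lp_P_lt: "m < l \<Longrightarrow> Lp l (P b a lam m) = 0"
  using P_monic[of b a lam m] by (simp add: Lp_degree_le coeff_eq_0)

lemma Lp_P_ge: "Lp l (P b a lam (l + k)) = (\<Prod>i=Suc l..l + k. a i)"
proof -
  let ?r = "\<Prod>i=Suc l..l + k. [:lam i, a i:]"
  have "d a lam (l + k) = d a lam l * ?r"
    unfolding d_def using prod.ub_add_nat[of 1 l _ k] by simp
  moreover from this have "?r \<noteq> 0"
    using d_nonzero[of "l + k"] by auto
  \<comment> \<open>Trading \<open>Q b a lam l\<close> for \<open>Q b a lam (l + k)\<close> brings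
    the degree of the polynomial factor within the index, as \<open>Lp_degree_le\<close>
    requires.\<close>
  ultimately have "to_fract (P b a lam (l + k)) * Q b a lam l =
      to_fract (P b a lam l * ?r) * Q b a lam (l + k)"
    using d_nonzero[of l] by (auto simp: Q_def field_simps)
  then have "Lp l (P b a lam (l + k)) = Lp (l + k) (P b a lam l * ?r)"
    by (simp only: Lp_def)
  then show ?thesis
    using linear_factors_mult[of "P b a lam l" l lam a k] P_monic[of b a lam l]
    by (simp only: Lp_degree_le mult_1_left)
qed

text \<open>Puts the closed form into the shape of \<open>path_sum_rec\<close> in the target
  column.\<close>

lemma Lp_P_rec:
  "Lp l (P b a lam m) = of_bool (m = l) + (if m = 0 then 0 else a m * Lp l (P b a lam (m - 1)))"
proof (cases m l rule: linorder_cases)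
  case less
  then show ?thesis
    by (simp only: Lp_P_lt less_imp_diff_less) simp
next
  case equal
  then show ?thesis
    using Lp_P_ge[of l 0] Lp_P_lt[of "m - 1" l] by (cases m) auto
next
  case greater
  then obtain k where "m = l + Suc k"
    by (auto dest: less_imp_Suc_add)
  then show ?thesis
    using Lp_P_ge[of l k] Lp_P_ge[of l "Suc k"] by (simp add: mult.commute)
qed

text \<open>The exponent counts the columns still to cross. The \<open>a m\<close> term keeps
  \<open>Suc n\<close> because its coefficient carries a factor x, just as a vertical step stays in
  its column.\<close>

lemma Lp_power_P_rec:
  "Lp l (monom 1 (Suc n) * P b a lam m) =
     Lp l (monom 1 n * P b a lam (Suc m)) + b m * Lp l (monom 1 n * P b a lam m) +
     (if m = 0 then 0
      else a m * Lp l (monom 1 (Suc n) * P b a lam (m - 1))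
         + lam m * Lp l (monom 1 n * P b a lam (m - 1)))"
proof -
  have monom: "monom 1 (Suc n) = [:0, 1:] * monom (1 :: complex) n"
    by (simp add: monom_Suc)
  have "monom 1 (Suc n) * P b a lam m = monom 1 n * ([:0, 1:] * P b a lam m)"
    unfolding monom by (simp only: ac_simps)
  also have "\<dots> = monom 1 n * P b a lam (Suc m) + smult (b m) (monom 1 n * P b a lam m) +
      (if m = 0 then 0
       else smult (a m) (monom 1 (Suc n) * P b a lam (m - 1))
          + smult (lam m) (monom 1 n * P b a lam (m - 1)))"
    unfolding P_rec monom by (simp add: algebra_simps smult_add_right)
  finally show ?thesis
    by (simp add: Lp_add Lp_smult Lp_zero)
qed

text \<open>The outer induction is on the remaining columns, with \<open>x\<close> arbitrary since
  the start moves right while the target stays; the inner one on \<open>m\<close> handles vertical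
  steps.\<close>

lemma Lp_eq_path_sum:
  "Lp l (monom 1 n * P b a lam m) = path_sum b a lam (x, int m) (x + int n, int l)"
proof (induction n arbitrary: m x)
  case 0
  show ?case
  proof (induction m)
    case 0
    show ?case
      by (subst path_sum_rec) (use Lp_P_rec[of l 0] in \<open>simp add: path_sum_backward flip: one_pCons\<close>)
  next
    case (Suc m)
    then show ?case
      by (subst path_sum_rec) (simp add: path_sum_backward Lp_P_rec[of l "Suc m"] monom_0)
  qed
next
  case (Suc n)
  have IH: "path_sum b a lam (x + 1, int k) (x + int (Suc n), int l) =
      Lp l (monom 1 n * P b a lam k)" for k
    using Suc.IH[of k "x + 1"] by (simp add: algebra_simps)
  show ?case
  proof (induction m)
    case 0
    show ?case
      by (subst path_sum_rec) (simp only: IH Lp_power_P_rec[of l n 0], simp)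
  next
    case (Suc m)
    show ?case
      \<comment> \<open>\<open>IH\<close> covers the steps into the next column;
        \<open>Suc.IH\<close> is now the inner hypothesis and covers the vertical step.\<close>
      by (subst path_sum_rec)
         (simp only: IH Lp_power_P_rec[of l n "Suc m"] diff_Suc_1 Suc.IH, simp)
  qed
qed

end

theorem theorem3p12:
  fixes a b lam :: "nat \<Rightarrow> complex"
    and L :: "ratfun \<Rightarrow> complex"
    and n m l :: nat
  assumes "\<And>k. k \<ge> 1 \<Longrightarrow> a k \<noteq> 0"
    and "\<And>k. k \<ge> 1 \<Longrightarrow> poly (P b a lam k) (- lam k / a k) \<noteq> 0"
    and "linear_functional_on (V b a lam) L"
    and "L 1 = 1"
    and "\<And>i j. i < j \<Longrightarrow> L (X ^ i * Q b a lam j) = 0"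
  shows "L (X ^ n * to_fract (P b a lam m) * Q b a lam l) =
    (\<Sum>\<pi> \<in> MS (0, int m) (int n, int l). wt b a lam (0, int m) \<pi>)"
proof -
  interpret rational_moment_functional a b lam L
    using assms by unfold_locales
  show ?thesis
    using Lp_eq_path_sum[of l n m 0]
    by (simp add: Lp_def path_sum_def power_X_eq)
qed

end
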